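(* Let $(\mathcal{S},\mathcal{A},r,p_\theta)$, $\theta\in\Theta$, be a family of Markov decision processes with true parameter $\theta_0$, let $\Pi$ be a class of policies with optimal policies $\pi_\theta^*\in\Pi$, let $\gamma\in(0,1]$ be the discount factor, let $\mu$ be a non-negative function on $\mathcal{S}\times\mathcal{A}$, let $\pi$ be the policy under which the data $H_t$ are generated, let $P_t$ be the prior on $\Theta$ at time $t$, and let $\epsilon_t>0$, $\epsilon_t\to0$. Suppose $\lambda(\mathcal{S},\mathcal{A})<\infty$ and there exist positive numbers $C_1,C_2,C_3,C_4$ such that $\gamma C_1C_2\lambda(\mathcal{S},\mathcal{A})<1$ and (i) $p_{\tilde\pi_t}(a|H_t)\le C_1$ for all $a\in\mathcal{A}$, all $\tilde\pi\in\Pi$ and all $H_t$, $t\in\{0,1,2,\dots\}$; (ii) $p_\theta(s'|s,a)\le C_2$ for all $s',s\in\mathcal{S}$, $a\in\mathcal{A}$, $\theta\in\Theta$; (iii) $|p_\theta(s'|s,a)-p_{\theta_0}(s'|s,a)|\le C_3\,d_\mu(\theta,\theta_0)^\rho$ for all $s',s\in\mathcal{S}$, $a\in\mathcal{A}$, $\theta\in\Theta$ and some $\rho\in(0,1]$; (iv) $|r(s,a)|\le C_4$ for all $s\in\mathcal{S}$, $a\in\mathcal{A}$. Suppose also that for every $M_t\to\infty$, $P_t(\theta\in\Theta:d_\mu(\theta,\theta_0)>M_t\epsilon_t\mid H_t)\to0$ in $P_{\theta_0,\pi}$-probability. Then for every $\tilde\pi\in\Pi$ and every $M_t\to\infty$,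 $$P_t(\theta\in\Theta:\ |V_\theta(\tilde\pi)-V_{\theta_0}(\tilde\pi)|>M_t\epsilon_t^\rho\mid H_t)\to0,$$ $$P_t(\theta\in\Theta:\ |V_\theta(\pi_\theta^* )-V_{\theta_0}(\pi_{\theta_0}^* )|>M_t\epsilon_t^\rho\mid H_t)\to0,$$ $$P_t(\theta\in\Theta:\ |V_{\theta_0}(\pi_\theta^* )-V_{\theta_0}(\pi_{\theta_0}^* )|>M_t\epsilon_t^\rho\mid H_t)\to0$$ in $P_{\theta_0,\pi}$-probability.
   Context: A Markov decision process (MDP) $(\mathcal{S},\mathcal{A},r,p_\theta)$ has state space $\mathcal{S}$, action space $\mathcal{A}$, reward function $r:\mathcal{S}\times\mathcal{A}\to\mathbb{R}$ and transition density $p_\theta(S_{t+1}|S_t,A_t)$, the conditional density of $S_{t+1}$ given $S_t,A_t$, for $t\in\{0,1,2,\dots\}$, indexed by $\theta\in\Theta$, where $\Theta$ may be infinite dimensional. The reward is $R_t=r(S_t,A_t)$, and the history up to time $t$ is $H_t=(S_0,A_0,R_0,\dots,S_{t-1},A_{t-1},R_{t-1},S_t)$. A policy $\pi$ is an infinite sequence of functions $\pi_t$ mapping histories $H_t$ to probability distributions on $\mathcal{A}$; under $\pi$ the action $A_t$ is drawn from $\pi_t(H_t)$, with density $p_{\pi_t}(\cdot|H_t)$. $P_{\theta,\pi}$ and $\mathbb{E}_{\theta,\pi}$ are the probability and expectation induced by the dynamics $\theta$ and the policy $\pi$ (with a fixed initial state distribution). Transition densities are taken with respect to a measure $m$ on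 $\mathcal{S}$, policy densities with respect to a measure $\kappa$ on $\mathcal{A}$, and $\lambda=m\otimes\kappa$ is the reference finite measure on $\mathcal{S}\times\mathcal{A}$; $\lambda(\mathcal{S},\mathcal{A})$ is its total mass. The value is $V_\theta(\pi)=\mathbb{E}_{\theta,\pi}(\sum_{t=0}^\infty\gamma^tR_t)$. For each $\theta\in\Theta$, the optimal policy $\pi_\theta^*\in\Pi$ satisfies $V_\theta(\pi_\theta^* )\ge V_\theta(\pi)$ for all $\pi\in\Pi$. $P_t(\cdot|H_t)$ is the posterior distribution of $\theta$ given $H_t$ under the prior $P_t$, where $H_t$ is generated from $P_{\theta_0,\pi}$. The semi-distance is $$d_\mu^2(\theta,\theta')=\int h^2\big(p_\theta(\cdot|s,a),p_{\theta'}(\cdot|s,a)\big)\mu(s,a)\,d\lambda(s,a),\quad h^2(p_1,p_2)=\int(\sqrt{p_1(x)}-\sqrt{p_2(x)})^2\,dm(x).$$ *)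

theory Defs
  imports "HOL-Probability.Probability"
begin

text \<open>
  A family of Markov decision processes over one state space, action space, reward and initial
  state distribution. The state and action spaces are the (underlying spaces of the) reference
  measures \<open>m\<close> and \<open>\<kappa>\<close>; \<open>\<Theta>\<close> is the space of \<open>params\<close>, of which only the
  sigma-algebra is used. \<open>trans_density F \<theta> (s, a) s'\<close> is the value \<open>p\<^sub>\<theta>(s' | s, a)\<close>.
\<close>

record ('s, 'a, 'p) mdp_family =
  state_ref :: "'s measure"
  action_ref :: "'a measure"
  init_dist :: "'s measure"
  reward :: "'s \<times> 'a \<Rightarrow> real"
  params :: "'p measure"
  trans_density :: "'p \<Rightarrow> 's \<times> 'a \<Rightarrow> 's \<Rightarrow> real"

definition step_ref :: "('s, 'a, 'p) mdp_family \<Rightarrow> ('s \<times> 'a) measure" where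
  "step_ref F = state_ref F \<Otimes>\<^sub>M action_ref F"

locale mdp_family =
  fixes F :: "('s, 'a, 'p) mdp_family"
  assumes sigma_finite_state_ref: "sigma_finite_measure (state_ref F)"
    and sigma_finite_action_ref: "sigma_finite_measure (action_ref F)"
    and prob_space_init_dist: "prob_space (init_dist F)"
    and sets_init_dist: "sets (init_dist F) = sets (state_ref F)"
    and measurable_reward: "reward F \<in> borel_measurable (step_ref F)"
    and measurable_trans: "(\<lambda>(\<theta>, x, s'). trans_density F \<theta> x s') \<in>
      borel_measurable (params F \<Otimes>\<^sub>M (step_ref F \<Otimes>\<^sub>M state_ref F))"
    and trans_nonneg: "\<And>\<theta> x s'. \<theta> \<in> space (params F) \<Longrightarrow> x \<in> space (step_ref F) \<Longrightarrow>
      s' \<in> space (state_ref F) \<Longrightarrow> 0 \<le> trans_density F \<theta> x s'"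
    and trans_integral: "\<And>\<theta> x. \<theta> \<in> space (params F) \<Longrightarrow> x \<in> space (step_ref F) \<Longrightarrow>
      (\<integral>\<^sup>+ s'. ennreal (trans_density F \<theta> x s') \<partial>state_ref F) = 1"

text \<open>
  A history \<open>H\<^sub>t\<close> is the tuple of the \<open>(S\<^sub>i, A\<^sub>i, R\<^sub>i)\<close>, \<open>i < t\<close>, together with \<open>S\<^sub>t\<close>.
  A trajectory is the sequence of the \<open>(S\<^sub>i, A\<^sub>i)\<close>, the rewards being functions of it;
  \<open>history_with F t \<omega> s\<close> uses only the first \<open>t\<close> entries of \<open>\<omega>\<close>, and has \<open>S\<^sub>t = s\<close>.
\<close>

type_synonym ('s, 'a) history = "(nat \<Rightarrow> 's \<times> 'a \<times> real) \<times> 's"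

definition history_space ::
    "('s, 'a, 'p) mdp_family \<Rightarrow> nat \<Rightarrow> ('s, 'a) history measure" where
  "history_space F t =
     (\<Pi>\<^sub>M i\<in>{0..<t}. state_ref F \<Otimes>\<^sub>M (action_ref F \<Otimes>\<^sub>M (borel :: real measure)))
       \<Otimes>\<^sub>M state_ref F"

definition history_with ::
    "('s, 'a, 'p) mdp_family \<Rightarrow> nat \<Rightarrow> (nat \<Rightarrow> 's \<times> 'a) \<Rightarrow> 's \<Rightarrow> ('s, 'a) history" where
  "history_with F t \<omega> s =
     (\<lambda>i\<in>{0..<t}. (fst (\<omega> i), snd (\<omega> i), reward F (fst (\<omega> i), snd (\<omega> i))), s)"

definition history ::
    "('s, 'a, 'p) mdp_family \<Rightarrow> nat \<Rightarrow> (nat \<Rightarrow> 's \<times> 'a) \<Rightarrow> ('s, 'a) history" where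
  "history F t \<omega> = history_with F t \<omega> (fst (\<omega> t))"

definition traj_space :: "('s, 'a, 'p) mdp_family \<Rightarrow> (nat \<Rightarrow> 's \<times> 'a) measure" where
  "traj_space F = (\<Pi>\<^sub>M i\<in>(UNIV :: nat set). step_ref F)"

text \<open>
  Policies are given by their densities: \<open>\<pi> t h a\<close> is the density at \<open>a\<close>, with respect to
  \<open>action_ref F\<close>, of the distribution which \<open>\<pi>\<close> assigns to the history \<open>h\<close> at time \<open>t\<close>.
\<close>

type_synonym ('s, 'a) policy = "nat \<Rightarrow> ('s, 'a) history \<Rightarrow> 'a \<Rightarrow> real"

definition policy :: "('s, 'a, 'p) mdp_family \<Rightarrow> ('s, 'a) policy \<Rightarrow> bool" where
  "policy F \<pi> \<longleftrightarrow> (\<forall>t.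
     (\<lambda>(h, a). \<pi> t h a) \<in> borel_measurable (history_space F t \<Otimes>\<^sub>M action_ref F) \<and>
     (\<forall>h\<in>space (history_space F t).
        (\<forall>a\<in>space (action_ref F). 0 \<le> \<pi> t h a) \<and>
        (\<integral>\<^sup>+ a. ennreal (\<pi> t h a) \<partial>action_ref F) = 1))"

definition state_kernel ::
    "('s, 'a, 'p) mdp_family \<Rightarrow> 'p \<Rightarrow> nat \<Rightarrow> (nat \<Rightarrow> 's \<times> 'a) \<Rightarrow> 's measure" where
  "state_kernel F \<theta> t \<omega> =
     (if t = 0 then init_dist F
      else density (state_ref F) (\<lambda>s'. ennreal (trans_density F \<theta> (\<omega> (t - 1)) s')))"

text \<open>The conditional law of \<open>(S\<^sub>t, A\<^sub>t)\<close> given the \<open>(S\<^sub>i, A\<^sub>i)\<close>, \<open>i < t\<close>.\<close>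

definition step_kernel ::
    "('s, 'a, 'p) mdp_family \<Rightarrow> 'p \<Rightarrow> ('s, 'a) policy \<Rightarrow> nat \<Rightarrow> (nat \<Rightarrow> 's \<times> 'a) \<Rightarrow>
      ('s \<times> 'a) measure" where
  "step_kernel F \<theta> \<pi> t \<omega> =
     density (state_kernel F \<theta> t \<omega> \<Otimes>\<^sub>M action_ref F)
       (\<lambda>(s, a). ennreal (\<pi> t (history_with F t \<omega> s) a))"

text \<open>
  \<open>P\<^bsub>\<theta>,\<pi>\<^esub>\<close>, by the Ionescu-Tulcea theorem. See \<open>Ionescu_Tulcea_step_kernel\<close> below for
  the interpretation.
\<close>

definition traj_law ::
    "('s, 'a, 'p) mdp_family \<Rightarrow> 'p \<Rightarrow> ('s, 'a) policy \<Rightarrow> (nat \<Rightarrow> 's \<times> 'a) measure" where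
  "traj_law F \<theta> \<pi> =
     projective_family.lim UNIV
       (Ionescu_Tulcea.CI (step_kernel F \<theta> \<pi>) (\<lambda>_. step_ref F)) (\<lambda>_. step_ref F)"

definition policy_value ::
    "('s, 'a, 'p) mdp_family \<Rightarrow> real \<Rightarrow> 'p \<Rightarrow> ('s, 'a) policy \<Rightarrow> real" where
  "policy_value F \<gamma> \<theta> \<pi> = (\<integral>\<omega>. (\<Sum>t. \<gamma> ^ t * reward F (\<omega> t)) \<partial>traj_law F \<theta> \<pi>)"

definition optimal_policy ::
    "('s, 'a, 'p) mdp_family \<Rightarrow> real \<Rightarrow> ('s, 'a) policy set \<Rightarrow> 'p \<Rightarrow> ('s, 'a) policy \<Rightarrow> bool" where
  "optimal_policy F \<gamma> Pol \<theta> \<pi> \<longleftrightarrow>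
     \<pi> \<in> Pol \<and> (\<forall>\<pi>'\<in>Pol. policy_value F \<gamma> \<theta> \<pi>' \<le> policy_value F \<gamma> \<theta> \<pi>)"

definition hellinger_sq :: "'s measure \<Rightarrow> ('s \<Rightarrow> real) \<Rightarrow> ('s \<Rightarrow> real) \<Rightarrow> ennreal" where
  "hellinger_sq m p1 p2 = (\<integral>\<^sup>+ x. ennreal ((sqrt (p1 x) - sqrt (p2 x))\<^sup>2) \<partial>m)"

text \<open>
  Powers with positive exponent on \<open>[0, \<infinity>]\<close>, because \<open>d\<^sub>\<mu>\<close> can be infinite when
  \<open>\<mu>\<close> is not integrable.
\<close>

definition epowr :: "ennreal \<Rightarrow> real \<Rightarrow> ennreal" where
  "epowr x a = (if x = \<infinity> then \<infinity> else ennreal (enn2real x powr a))"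

definition d_mu ::
    "('s, 'a, 'p) mdp_family \<Rightarrow> ('s \<times> 'a \<Rightarrow> real) \<Rightarrow> 'p \<Rightarrow> 'p \<Rightarrow> ennreal" where
  "d_mu F \<mu> \<theta> \<theta>' =
     epowr (\<integral>\<^sup>+ x. hellinger_sq (state_ref F) (trans_density F \<theta> x) (trans_density F \<theta>' x) *
              ennreal (\<mu> x) \<partial>step_ref F) (1 / 2)"

text \<open>
  \<open>K\<close> is (a version of) the posterior distribution of \<open>\<theta>\<close> given \<open>H\<^sub>t\<close> when \<open>\<theta>\<close> has law
  \<open>prior\<close> and, given \<open>\<theta>\<close>, the trajectory has law \<open>P\<^bsub>\<theta>,\<pi>\<^esub>\<close>: a Markov kernel that
  disintegrates the joint law of \<open>\<theta>\<close> and \<open>H\<^sub>t\<close> along the marginal law of \<open>H\<^sub>t\<close>.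
\<close>

definition posterior ::
    "('s, 'a, 'p) mdp_family \<Rightarrow> ('s, 'a) policy \<Rightarrow> 'p measure \<Rightarrow> nat \<Rightarrow>
      (('s, 'a) history \<Rightarrow> 'p measure) \<Rightarrow> bool" where
  "posterior F \<pi> prior t K \<longleftrightarrow>
     K \<in> history_space F t \<rightarrow>\<^sub>M prob_algebra (params F) \<and>
     (\<forall>B\<in>sets (params F). \<forall>C\<in>sets (history_space F t).
        (\<integral>\<^sup>+ \<theta>. indicator B \<theta> * emeasure (distr (traj_law F \<theta> \<pi>) (history_space F t) (history F t)) C
           \<partial>prior) =
        (\<integral>\<^sup>+ \<theta>. (\<integral>\<^sup>+ h. indicator C h * emeasure (K h) B
                  \<partial>distr (traj_law F \<theta> \<pi>) (history_space F t) (history F t)) \<partial>prior))"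

text \<open>
  Convergence to zero in probability. Outer measure stands in for measure, here and in the
  next definition, because sets of parameters defined through \<open>\<theta> \<mapsto> \<pi>\<^sub>\<theta>\<^sup>*\<close> need not be
  measurable; on measurable sets it is the measure itself.
\<close>

definition tendsto_zero_in_prob :: "'w measure \<Rightarrow> (nat \<Rightarrow> 'w \<Rightarrow> ennreal) \<Rightarrow> bool" where
  "tendsto_zero_in_prob P X \<longleftrightarrow>
     (\<forall>\<delta>>0. (\<lambda>t. outer_measure_of P {\<omega>\<in>space P. ennreal \<delta> < X t \<omega>}) \<longlonglongrightarrow> 0)"

definition posterior_vanishes ::
    "('s, 'a, 'p) mdp_family \<Rightarrow> 'p \<Rightarrow> ('s, 'a) policy \<Rightarrow>
      (nat \<Rightarrow> ('s, 'a) history \<Rightarrow> 'p measure) \<Rightarrow> (nat \<Rightarrow> 'p set) \<Rightarrow> bool" where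
  "posterior_vanishes F \<theta>\<^sub>0 \<pi> K B \<longleftrightarrow>
     tendsto_zero_in_prob (traj_law F \<theta>\<^sub>0 \<pi>)
       (\<lambda>t \<omega>. outer_measure_of (K t (history F t \<omega>)) (B t))"

context mdp_family
begin

lemma measurable_trans_at:
  assumes "\<theta> \<in> space (params F)"
  shows "(\<lambda>(x, s'). trans_density F \<theta> x s') \<in> borel_measurable (step_ref F \<Otimes>\<^sub>M state_ref F)"
  using measurable_compose[OF measurable_Pair1'[OF assms] measurable_trans]
  by (simp add: split_beta')

lemma measurable_history_with:
  "(\<lambda>(\<omega>, s). history_with F t \<omega> s) \<in>
     (\<Pi>\<^sub>M i\<in>{0..<t}. step_ref F) \<Otimes>\<^sub>M state_ref F \<rightarrow>\<^sub>M history_space F t"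
proof -
  have [measurable]: "reward F \<in> borel_measurable (state_ref F \<Otimes>\<^sub>M action_ref F)"
    using measurable_reward by (simp add: step_ref_def)
  show ?thesis
    unfolding history_space_def history_with_def step_ref_def split_beta'
    by measurable
qed

lemma sets_state_kernel: "sets (state_kernel F \<theta> t \<omega>) = sets (state_ref F)"
  by (simp add: state_kernel_def sets_init_dist)

lemma sets_step_kernel: "sets (step_kernel F \<theta> \<pi> t \<omega>) = sets (step_ref F)"
  unfolding step_kernel_def step_ref_def sets_density
  by (intro sets_pair_measure_cong sets_state_kernel refl)

lemma nn_integral_state_kernel:
  assumes "\<theta> \<in> space (params F)" "\<omega> \<in> space (\<Pi>\<^sub>M i\<in>{0..<t}. step_ref F)"
    and f: "f \<in> borel_measurable (state_ref F)"
  shows "(\<integral>\<^sup>+ s. f s \<partial>state_kernel F \<theta> t \<omega>) =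
    (if t = 0 then (\<integral>\<^sup>+ s. f s \<partial>init_dist F)
     else (\<integral>\<^sup>+ s. ennreal (trans_density F \<theta> (\<omega> (t - 1)) s) * f s \<partial>state_ref F))"
proof (cases "t = 0")
  case False
  then have "\<omega> (t - 1) \<in> space (step_ref F)"
    using assms(2) by (auto simp: space_PiM)
  from measurable_compose[OF measurable_Pair1'[OF this] measurable_trans_at[OF assms(1)]]
  have [measurable]: "trans_density F \<theta> (\<omega> (t - 1)) \<in> borel_measurable (state_ref F)"
    by simp
  show ?thesis
    unfolding state_kernel_def using False by (simp only: if_False) (rule nn_integral_density; use f in measurable)
qed (simp add: state_kernel_def)

lemma prob_space_state_kernel:
  assumes "\<theta> \<in> space (params F)" "\<omega> \<in> space (\<Pi>\<^sub>M i\<in>{0..<t}. step_ref F)"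
  shows "prob_space (state_kernel F \<theta> t \<omega>)"
proof
  have "t \<noteq> 0 \<Longrightarrow> \<omega> (t - 1) \<in> space (step_ref F)"
    using assms(2) by (auto simp: space_PiM)
  then have "(\<integral>\<^sup>+ s. 1 \<partial>state_kernel F \<theta> t \<omega>) = 1"
    using assms trans_integral prob_space.emeasure_space_1[OF prob_space_init_dist]
    by (subst nn_integral_state_kernel) auto
  then show "emeasure (state_kernel F \<theta> t \<omega>) (space (state_kernel F \<theta> t \<omega>)) = 1"
    by simp
qed

lemma measurable_policy_history:
  assumes "policy F \<pi>"
  shows "(\<lambda>(\<omega>, s, a). \<pi> t (history_with F t \<omega> s) a) \<in>
    borel_measurable ((\<Pi>\<^sub>M i\<in>{0..<t}. step_ref F) \<Otimes>\<^sub>M (state_ref F \<Otimes>\<^sub>M action_ref F))"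
proof -
  have [measurable]: "(\<lambda>(h, a). \<pi> t h a) \<in>
      borel_measurable (history_space F t \<Otimes>\<^sub>M action_ref F)"
    using assms by (simp add: policy_def)
  note [measurable] = measurable_history_with
  show ?thesis
    by measurable
qed

lemma nn_integral_step_kernel:
  assumes \<theta>: "\<theta> \<in> space (params F)" and \<pi>: "policy F \<pi>"
    and \<omega>: "\<omega> \<in> space (\<Pi>\<^sub>M i\<in>{0..<t}. step_ref F)"
    and f[measurable]: "f \<in> borel_measurable (step_ref F)"
  shows "(\<integral>\<^sup>+ x. f x \<partial>step_kernel F \<theta> \<pi> t \<omega>) =
    (\<integral>\<^sup>+ s. (\<integral>\<^sup>+ a. ennreal (\<pi> t (history_with F t \<omega> s) a) * f (s, a) \<partial>action_ref F)
       \<partial>state_kernel F \<theta> t \<omega>)"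
proof -
  interpret A: sigma_finite_measure "action_ref F"
    by (rule sigma_finite_action_ref)
  note sets_state_kernel[measurable_cong]
  have f'[measurable]: "f \<in> borel_measurable (state_ref F \<Otimes>\<^sub>M action_ref F)"
    using f by (simp add: step_ref_def)
  have p[measurable]: "(\<lambda>(s, a). \<pi> t (history_with F t \<omega> s) a) \<in>
      borel_measurable (state_ref F \<Otimes>\<^sub>M action_ref F)"
    using measurable_compose[OF measurable_Pair1'[OF \<omega>] measurable_policy_history[OF \<pi>]]
    by (simp add: split_beta')
  show ?thesis
    unfolding step_kernel_def
    by (subst nn_integral_density) (simp_all add: A.nn_integral_fst[symmetric] split_beta')
qed

lemma prob_space_step_kernel:
  assumes \<theta>: "\<theta> \<in> space (params F)" and \<pi>: "policy F \<pi>"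
    and \<omega>: "\<omega> \<in> space (\<Pi>\<^sub>M i\<in>{0..<t}. step_ref F)"
  shows "prob_space (step_kernel F \<theta> \<pi> t \<omega>)"
proof
  interpret K: prob_space "state_kernel F \<theta> t \<omega>"
    by (rule prob_space_state_kernel[OF \<theta> \<omega>])
  have "(\<integral>\<^sup>+ a. ennreal (\<pi> t (history_with F t \<omega> s) a) \<partial>action_ref F) = 1"
    if "s \<in> space (state_kernel F \<theta> t \<omega>)" for s
  proof -
    have "(\<omega>, s) \<in> space ((\<Pi>\<^sub>M i\<in>{0..<t}. step_ref F) \<Otimes>\<^sub>M state_ref F)"
      using that \<omega> sets_eq_imp_space_eq[OF sets_state_kernel] by (auto simp: space_pair_measure)
    from measurable_space[OF measurable_history_with this] show ?thesis
      using \<pi> by (simp add: policy_def)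
  qed
  then have "(\<integral>\<^sup>+ x. 1 \<partial>step_kernel F \<theta> \<pi> t \<omega>) = (\<integral>\<^sup>+ s. 1 \<partial>state_kernel F \<theta> t \<omega>)"
    by (subst nn_integral_step_kernel[OF \<theta> \<pi> \<omega>])
      (simp_all only: borel_measurable_const mult_1_right cong: nn_integral_cong)
  then show "emeasure (step_kernel F \<theta> \<pi> t \<omega>) (space (step_kernel F \<theta> \<pi> t \<omega>)) = 1"
    by (simp add: K.emeasure_space_1)
qed

lemma measurable_step_kernel:
  assumes \<theta>: "\<theta> \<in> space (params F)" and \<pi>: "policy F \<pi>"
  shows "step_kernel F \<theta> \<pi> t \<in> (\<Pi>\<^sub>M i\<in>{0..<t}. step_ref F) \<rightarrow>\<^sub>M subprob_algebra (step_ref F)"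
proof (rule measurable_subprob_algebra)
  fix \<omega> assume "\<omega> \<in> space (\<Pi>\<^sub>M i\<in>{0..<t}. step_ref F)"
  then show "subprob_space (step_kernel F \<theta> \<pi> t \<omega>)"
    by (intro prob_space_imp_subprob_space prob_space_step_kernel[OF \<theta> \<pi>])
  show "sets (step_kernel F \<theta> \<pi> t \<omega>) = sets (step_ref F)"
    by (rule sets_step_kernel)
next
  fix B assume B: "B \<in> sets (step_ref F)"
  interpret A: sigma_finite_measure "action_ref F"
    by (rule sigma_finite_action_ref)
  interpret S: sigma_finite_measure "state_ref F"
    by (rule sigma_finite_state_ref)
  interpret I: prob_space "init_dist F"
    by (rule prob_space_init_dist)
  note sets_init_dist[measurable_cong]
  note [measurable] = measurable_policy_history[OF \<pi>] measurable_trans_at[OF \<theta>]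
  have B'[measurable]: "B \<in> sets (state_ref F \<Otimes>\<^sub>M action_ref F)"
    using B by (simp add: step_ref_def)
  define g where "g = (\<lambda>\<omega> s. \<integral>\<^sup>+ a. ennreal (\<pi> t (history_with F t \<omega> s) a) * indicator B (s, a)
    \<partial>action_ref F)"
  have g[measurable]: "(\<lambda>(\<omega>, s). g \<omega> s) \<in>
      borel_measurable ((\<Pi>\<^sub>M i\<in>{0..<t}. step_ref F) \<Otimes>\<^sub>M state_ref F)"
  proof -
    have "(\<lambda>z. \<pi> t (history_with F t (fst (fst z)) (snd (fst z))) (snd z)) \<in>
        borel_measurable (((\<Pi>\<^sub>M i\<in>{0..<t}. step_ref F) \<Otimes>\<^sub>M state_ref F) \<Otimes>\<^sub>M action_ref F)"
      using measurable_compose[OF _ measurable_policy_history[OF \<pi>, of t],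
        of "\<lambda>z. (fst (fst z), snd (fst z), snd z)"]
      by (simp add: split_beta')
    moreover have "(\<lambda>z. indicator B (snd (fst z), snd z) :: ennreal) \<in>
        borel_measurable (((\<Pi>\<^sub>M i\<in>{0..<t}. step_ref F) \<Otimes>\<^sub>M state_ref F) \<Otimes>\<^sub>M action_ref F)"
      using measurable_compose[OF _ borel_measurable_indicator[OF B'],
        of "\<lambda>z. (snd (fst z), snd z)"]
      by simp
    ultimately show ?thesis
      unfolding g_def split_beta'
      by (intro A.borel_measurable_nn_integral) (simp add: split_beta')
  qed
  have eq: "emeasure (step_kernel F \<theta> \<pi> t \<omega>) B =
      (if t = 0 then (\<integral>\<^sup>+ s. g \<omega> s \<partial>init_dist F)
       else (\<integral>\<^sup>+ s. ennreal (trans_density F \<theta> (\<omega> (t - 1)) s) * g \<omega> s \<partial>state_ref F))"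
    if \<omega>: "\<omega> \<in> space (\<Pi>\<^sub>M i\<in>{0..<t}. step_ref F)" for \<omega>
  proof -
    have g\<omega>: "g \<omega> \<in> borel_measurable (state_ref F)"
      using measurable_compose[OF measurable_Pair1'[OF \<omega>] g] by simp
    have "emeasure (step_kernel F \<theta> \<pi> t \<omega>) B =
        (\<integral>\<^sup>+ x. indicator B x \<partial>step_kernel F \<theta> \<pi> t \<omega>)"
      using B by (simp add: sets_step_kernel)
    also have "\<dots> = (\<integral>\<^sup>+ s. g \<omega> s \<partial>state_kernel F \<theta> t \<omega>)"
      unfolding g_def using B by (intro nn_integral_step_kernel[OF \<theta> \<pi> \<omega>]) auto
    finally show ?thesis
      using nn_integral_state_kernel[OF \<theta> \<omega> g\<omega>] by simp
  qed
  show "(\<lambda>\<omega>. emeasure (step_kernel F \<theta> \<pi> t \<omega>) B) \<in>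
      borel_measurable (\<Pi>\<^sub>M i\<in>{0..<t}. step_ref F)"
  proof (cases "t = 0")
    case True
    have "(\<lambda>\<omega>. \<integral>\<^sup>+ s. g \<omega> s \<partial>init_dist F) \<in> borel_measurable (\<Pi>\<^sub>M i\<in>{0..<t}. step_ref F)"
      by measurable
    then show ?thesis
      using True by (subst measurable_cong[OF eq]) auto
  next
    case False
    then have [measurable]: "(\<lambda>\<omega>. \<omega> (t - 1)) \<in> (\<Pi>\<^sub>M i\<in>{0..<t}. step_ref F) \<rightarrow>\<^sub>M step_ref F"
      by (intro measurable_component_singleton) auto
    have "(\<lambda>\<omega>. \<integral>\<^sup>+ s. ennreal (trans_density F \<theta> (\<omega> (t - 1)) s) * g \<omega> s \<partial>state_ref F) \<in>
        borel_measurable (\<Pi>\<^sub>M i\<in>{0..<t}. step_ref F)"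
      by measurable
    then show ?thesis
      using False by (subst measurable_cong[OF eq]) auto
  qed
qed

lemma Ionescu_Tulcea_step_kernel:
  assumes "\<theta> \<in> space (params F)" "policy F \<pi>"
  shows "Ionescu_Tulcea (step_kernel F \<theta> \<pi>) (\<lambda>_. step_ref F)"
  by (intro Ionescu_Tulcea.intro measurable_step_kernel prob_space_step_kernel assms)

lemma prob_space_traj_law:
  assumes "\<theta> \<in> space (params F)" "policy F \<pi>"
  shows "prob_space (traj_law F \<theta> \<pi>)"
proof -
  interpret IT: Ionescu_Tulcea "step_kernel F \<theta> \<pi>" "\<lambda>_. step_ref F"
    by (rule Ionescu_Tulcea_step_kernel[OF assms])
  have "emeasure (traj_law F \<theta> \<pi>) (IT.PF.emb UNIV {} (space (Pi\<^sub>M {} (\<lambda>_. step_ref F)))) =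
      emeasure (IT.CI {}) (space (Pi\<^sub>M {} (\<lambda>_. step_ref F)))"
    unfolding traj_law_def by (rule IT.lim) auto
  also have "\<dots> = 1"
    using prob_space.emeasure_space_1[OF IT.PF.prob_space_P[of "{}"]]
    by (simp add: IT.CI_def)
  finally show ?thesis
    by (intro prob_spaceI) (simp add: traj_law_def prod_emb_def space_PiM vimage_def restrict_def)
qed

lemma sets_traj_law:
  assumes "\<theta> \<in> space (params F)" "policy F \<pi>"
  shows "sets (traj_law F \<theta> \<pi>) = sets (traj_space F)"
proof -
  interpret IT: Ionescu_Tulcea "step_kernel F \<theta> \<pi>" "\<lambda>_. step_ref F"
    by (rule Ionescu_Tulcea_step_kernel[OF assms])
  show ?thesis
    by (simp add: traj_law_def traj_space_def)
qed

lemma measurable_history: "history F t \<in> traj_space F \<rightarrow>\<^sub>M history_space F t"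
proof -
  have "(\<lambda>\<omega>. restrict \<omega> {0..<t}) \<in> traj_space F \<rightarrow>\<^sub>M (\<Pi>\<^sub>M i\<in>{0..<t}. step_ref F)"
    unfolding traj_space_def by (intro measurable_restrict_subset) simp
  moreover have "(\<lambda>\<omega>. fst (\<omega> t)) \<in> traj_space F \<rightarrow>\<^sub>M state_ref F"
    unfolding traj_space_def
    by (rule measurable_compose[OF measurable_component_singleton[of t UNIV "\<lambda>_. step_ref F"]])
      (simp_all add: step_ref_def)
  ultimately have "(\<lambda>\<omega>. (restrict \<omega> {0..<t}, fst (\<omega> t))) \<in>
      traj_space F \<rightarrow>\<^sub>M (\<Pi>\<^sub>M i\<in>{0..<t}. step_ref F) \<Otimes>\<^sub>M state_ref F"
    by (rule measurable_Pair)
  from measurable_compose[OF this measurable_history_with]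
  have "(\<lambda>\<omega>. history_with F t (restrict \<omega> {0..<t}) (fst (\<omega> t))) \<in>
      traj_space F \<rightarrow>\<^sub>M history_space F t"
    by simp
  also have "(\<lambda>\<omega>. history_with F t (restrict \<omega> {0..<t}) (fst (\<omega> t))) = history F t"
    by (rule ext) (simp add: history_def history_with_def restrict_def cong: if_cong)
  finally show ?thesis .
qed

end

end

theory Submission
  imports Defs
begin

text \<open>
  The policy and transition densities integrate to one, so \<open>C\<^sub>1 C\<^sub>2 \<lambda>(S, A) \<ge> 1\<close>, and the
  hypothesis \<open>\<gamma> C\<^sub>1 C\<^sub>2 \<lambda>(S, A) < 1\<close> forces \<open>\<gamma> < 1\<close>. If
  \<open>\<bar>p\<^sub>\<theta> - p\<^bsub>\<theta>'\<^esub>\<bar> \<le> \<eta>\<close>, then exchanging \<open>\<theta>\<close> for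
  \<open>\<theta>'\<close> in one step changes the expectation of a function with values in \<open>[0, B]\<close> by at most
  \<open>\<eta> B m(S)\<close>, whatever the policy; these errors add up along the trajectory, so that the
  expectations of \<open>R\<^sub>t\<close> differ by \<open>O((t + 1) \<eta>)\<close>, and the discounted sum converges.
  Thus \<open>\<bar>V\<^sub>\<theta> - V\<^bsub>\<theta>\<^sub>0\<^esub>\<bar> \<le> L d\<^sub>\<mu>(\<theta>, \<theta>\<^sub>0)\<^sup>\<rho>\<close> uniformly over
  \<open>\<Pi>\<close>; with optimality all three value gaps are at most \<open>2 L d\<^sub>\<mu>(\<theta>, \<theta>\<^sub>0)\<^sup>\<rho>\<close>, and the
  contraction rate of \<open>d\<^sub>\<mu>\<close> carries over.
\<close>

context mdp_family
begin

section \<open>Exchanging the dynamics in a single step\<close>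

text \<open>Only the law of the state depends on the dynamics; given the state, the action is drawn
  from the same policy under both parameters. Averaging over the action leaves a function of the
  state that is still bounded by \<open>B\<close>, and the pointwise error \<open>\<eta> * B\<close>
  is then integrated over the whole state space. A one-sided bound in \<open>ennreal\<close> avoids
  subtraction.\<close>

lemma nn_integral_step_kernel_le:
  assumes \<theta>: "\<theta> \<in> space (params F)" "\<theta>' \<in> space (params F)" and \<pi>: "policy F \<pi>"
    and \<omega>: "\<omega> \<in> space (\<Pi>\<^sub>M i\<in>{0..<t}. step_ref F)"
    and \<eta>: "\<And>x s. x \<in> space (step_ref F) \<Longrightarrow> s \<in> space (state_ref F) \<Longrightarrow>
      ennreal (trans_density F \<theta> x s) \<le> ennreal (trans_density F \<theta>' x s) + \<eta>"
    and f: "f \<in> borel_measurable (step_ref F)"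
    and B: "\<And>x. x \<in> space (step_ref F) \<Longrightarrow> f x \<le> B"
  shows "(\<integral>\<^sup>+ x. f x \<partial>step_kernel F \<theta> \<pi> t \<omega>) \<le>
    (\<integral>\<^sup>+ x. f x \<partial>step_kernel F \<theta>' \<pi> t \<omega>) + \<eta> * B * emeasure (state_ref F) (space (state_ref F))"
proof -
  interpret A: sigma_finite_measure "action_ref F"
    by (rule sigma_finite_action_ref)
  \<comment> \<open>\<open>u s\<close> is the mean of \<open>f\<close> over the action chosen in
    state \<open>s\<close>. It is the same for both parameters, so the two integrals differ only in
    the measure against which \<open>u\<close> is integrated.\<close>
  define u where "u s = (\<integral>\<^sup>+ a. ennreal (\<pi> t (history_with F t \<omega> s) a) * f (s, a) \<partial>action_ref F)" for s
  have [measurable]: "f \<in> borel_measurable (state_ref F \<Otimes>\<^sub>M action_ref F)"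
    using f by (simp add: step_ref_def)
  have [measurable]: "(\<lambda>(s, a). \<pi> t (history_with F t \<omega> s) a) \<in>
      borel_measurable (state_ref F \<Otimes>\<^sub>M action_ref F)"
    using measurable_compose[OF measurable_Pair1'[OF \<omega>] measurable_policy_history[OF \<pi>]]
    by (simp add: split_beta')
  have u[measurable]: "u \<in> borel_measurable (state_ref F)"
    unfolding u_def by measurable
  have u_le: "u s \<le> B" if s: "s \<in> space (state_ref F)" for s
  proof -
    have h: "history_with F t \<omega> s \<in> space (history_space F t)"
      using measurable_space[OF measurable_history_with, of "(\<omega>, s)" t] \<omega> s
      by (simp add: space_pair_measure)
    have [measurable]: "\<pi> t (history_with F t \<omega> s) \<in> borel_measurable (action_ref F)"
      using \<pi> measurable_compose[OF measurable_Pair1'[OF h], of "\<lambda>(h, a). \<pi> t h a"]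
      by (simp add: policy_def)
    have "u s \<le> (\<integral>\<^sup>+ a. ennreal (\<pi> t (history_with F t \<omega> s) a) * B \<partial>action_ref F)"
      unfolding u_def using s
      by (intro nn_integral_mono mult_left_mono B) (auto simp: step_ref_def space_pair_measure)
    also have "\<dots> = B"
      using \<pi> h by (subst nn_integral_multc) (auto simp: policy_def)
    finally show ?thesis .
  qed
  have K: "(\<integral>\<^sup>+ x. f x \<partial>step_kernel F \<theta> \<pi> t \<omega>) = (\<integral>\<^sup>+ s. u s \<partial>state_kernel F \<theta> t \<omega>)"
    if "\<theta> \<in> space (params F)" for \<theta>
    unfolding u_def by (rule nn_integral_step_kernel[OF that \<pi> \<omega> f])
  show ?thesis
  proof (cases "t = 0")
    \<comment> \<open>The initial distribution is common to the whole family, so time 0 contributes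
      no error.\<close>
    case True
    then show ?thesis
      unfolding K[OF \<theta>(1)] K[OF \<theta>(2)] nn_integral_state_kernel[OF \<theta>(1) \<omega> u]
        nn_integral_state_kernel[OF \<theta>(2) \<omega> u]
      by simp
  next
    case False
    then have x: "\<omega> (t - 1) \<in> space (step_ref F)"
      using \<omega> by (auto simp: space_PiM)
    have p: "trans_density F \<theta>' (\<omega> (t - 1)) \<in> borel_measurable (state_ref F)"
      using measurable_compose[OF measurable_Pair1'[OF x] measurable_trans_at[OF \<theta>(2)]] by simp
    have "(\<integral>\<^sup>+ s. ennreal (trans_density F \<theta> (\<omega> (t - 1)) s) * u s \<partial>state_ref F) \<le>
        (\<integral>\<^sup>+ s. ennreal (trans_density F \<theta>' (\<omega> (t - 1)) s) * u s + \<eta> * B \<partial>state_ref F)"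
    proof (rule nn_integral_mono)
      fix s assume s: "s \<in> space (state_ref F)"
      have "ennreal (trans_density F \<theta> (\<omega> (t - 1)) s) * u s \<le>
          (ennreal (trans_density F \<theta>' (\<omega> (t - 1)) s) + \<eta>) * u s"
        by (intro mult_right_mono \<eta> x s) simp
      also have "\<dots> \<le> ennreal (trans_density F \<theta>' (\<omega> (t - 1)) s) * u s + \<eta> * B"
        unfolding distrib_right by (intro add_left_mono mult_left_mono u_le s) simp
      finally show "ennreal (trans_density F \<theta> (\<omega> (t - 1)) s) * u s \<le>
        ennreal (trans_density F \<theta>' (\<omega> (t - 1)) s) * u s + \<eta> * B" .
    qed
    also have "\<dots> = (\<integral>\<^sup>+ s. ennreal (trans_density F \<theta>' (\<omega> (t - 1)) s) * u s \<partial>state_ref F) +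
        \<eta> * B * emeasure (state_ref F) (space (state_ref F))"
      using p u by (subst nn_integral_add) (auto simp del: One_nat_def)
    finally show ?thesis
      using \<theta> False by (simp add: K nn_integral_state_kernel[OF _ \<omega> u])
  qed
qed

section \<open>Finite-horizon expectations under the trajectory law\<close>

lemma measurable_reward_component:
  assumes "i \<in> I"
  shows "(\<lambda>\<omega>. reward F (\<omega> i)) \<in> borel_measurable (\<Pi>\<^sub>M i\<in>I. step_ref F)"
  using measurable_component_singleton[OF assms, of "\<lambda>_. step_ref F"] measurable_reward
  by (rule measurable_compose)

lemma measurable_restrict_traj:
  "(\<lambda>\<omega>. restrict \<omega> {0..<n}) \<in> traj_space F \<rightarrow>\<^sub>M (\<Pi>\<^sub>M i\<in>{0..<n}. step_ref F)"
  unfolding traj_space_def by (intro measurable_restrict_subset) simp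

lemma measurable_fun_upd_step:
  assumes "\<omega> \<in> space (\<Pi>\<^sub>M i\<in>{0..<n}. step_ref F)"
  shows "fun_upd \<omega> n \<in> step_ref F \<rightarrow>\<^sub>M (\<Pi>\<^sub>M i\<in>{0..<Suc n}. step_ref F)"
  by (rule measurable_fun_upd[where J="{0..<n}"]) (use assms in auto)

text \<open>This is the tower property: \<open>G\<close> is the conditional expectation of
  \<open>g\<close> given the first \<open>n\<close> steps. Peeling off the last step in this way
  drives the induction on the horizon.\<close>

lemma nn_integral_traj_law_Suc:
  assumes \<theta>: "\<theta> \<in> space (params F)" and \<pi>: "policy F \<pi>"
    and g: "g \<in> borel_measurable (\<Pi>\<^sub>M i\<in>{0..<Suc n}. step_ref F)"
  defines "G \<equiv> \<lambda>\<omega>. \<integral>\<^sup>+ x. g (fun_upd \<omega> n x) \<partial>step_kernel F \<theta> \<pi> n \<omega>"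
  shows "G \<in> borel_measurable (\<Pi>\<^sub>M i\<in>{0..<n}. step_ref F)"
    and "(\<integral>\<^sup>+ \<omega>. g (restrict \<omega> {0..<Suc n}) \<partial>traj_law F \<theta> \<pi>) =
      (\<integral>\<^sup>+ \<omega>. G (restrict \<omega> {0..<n}) \<partial>traj_law F \<theta> \<pi>)"
proof -
  interpret IT: Ionescu_Tulcea "step_kernel F \<theta> \<pi>" "\<lambda>_. step_ref F"
    by (rule Ionescu_Tulcea_step_kernel[OF \<theta> \<pi>])
  \<comment> \<open>The law of the first \<open>k\<close> steps is the composition of the first
    \<open>k\<close> kernels. Its starting point \<open>\<lambda>_. undefined\<close> is the empty
    trajectory, the only element of the product over the empty index set.\<close>
  have C: "(\<integral>\<^sup>+ \<omega>. h (restrict \<omega> {0..<k}) \<partial>traj_law F \<theta> \<pi>) = (\<integral>\<^sup>+ \<omega>. h \<omega> \<partial>IT.C 0 k (\<lambda>_. undefined))"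
    if h: "h \<in> borel_measurable (\<Pi>\<^sub>M i\<in>{0..<k}. step_ref F)" for h :: "_ \<Rightarrow> ennreal" and k
  proof -
    have "IT.CI {0..<k} = IT.C 0 k (\<lambda>_. undefined)"
    proof (rule measure_eqI)
      have s: "sets (IT.C 0 k (\<lambda>_. undefined)) = sets (\<Pi>\<^sub>M i\<in>{0..<k}. step_ref F)"
        using IT.sets_C[of "\<lambda>_. undefined" 0 k] by simp
      show "sets (IT.CI {0..<k}) = sets (IT.C 0 k (\<lambda>_. undefined))"
        unfolding s by (simp add: IT.CI_def)
      fix X assume "X \<in> sets (IT.CI {0..<k})"
      then have X: "X \<in> sets (\<Pi>\<^sub>M i\<in>{0..<k}. step_ref F)"
        by (simp add: IT.CI_def)
      \<comment> \<open>The index set is a full initial segment, so the cylinder over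
        \<open>X\<close> is \<open>X\<close> itself.\<close>
      show "emeasure (IT.CI {0..<k}) X = emeasure (IT.C 0 k (\<lambda>_. undefined)) X"
        using IT.emeasure_CI[OF order_refl X] sets.sets_into_space[OF X]
        by (simp add: prod_emb_id space_PiM)
    qed
    then have "IT.C 0 k (\<lambda>_. undefined) =
        distr (traj_law F \<theta> \<pi>) (\<Pi>\<^sub>M i\<in>{0..<k}. step_ref F) (\<lambda>\<omega>. restrict \<omega> {0..<k})"
      using IT.distr_lim[of "{0..<k}"] by (simp add: traj_law_def)
    then show ?thesis
      using h measurable_restrict_traj
      by (simp add: nn_integral_distr measurable_cong_sets[OF sets_traj_law[OF \<theta> \<pi>] refl])
  qed
  \<comment> \<open>\<open>IT.eP n \<omega>\<close> is the law of \<open>\<omega>\<close> extended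
    by one step drawn from the kernel.\<close>
  have G_eq: "G \<omega> = (\<integral>\<^sup>+ x. g x \<partial>IT.eP n \<omega>)" if "\<omega> \<in> space (\<Pi>\<^sub>M i\<in>{0..<n}. step_ref F)" for \<omega>
    unfolding G_def by (rule IT.nn_integral_eP[OF that g, symmetric])
  have "(\<lambda>\<omega>. \<integral>\<^sup>+ x. g x \<partial>IT.eP n \<omega>) \<in> borel_measurable (\<Pi>\<^sub>M i\<in>{0..<n}. step_ref F)"
    by (rule measurable_compose[OF IT.measurable_eP nn_integral_measurable_subprob_algebra[OF g]])
  then show G: "G \<in> borel_measurable (\<Pi>\<^sub>M i\<in>{0..<n}. step_ref F)"
    by (simp add: G_eq cong: measurable_cong)
  have sp: "space (IT.C 0 n (\<lambda>_. undefined)) = space (\<Pi>\<^sub>M i\<in>{0..<n}. step_ref F)"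
    using IT.space_C[of "\<lambda>_. undefined" 0 n] by simp
  have "(\<integral>\<^sup>+ \<omega>. g \<omega> \<partial>IT.C 0 (Suc n) (\<lambda>_. undefined)) =
      (\<integral>\<^sup>+ \<omega>. \<integral>\<^sup>+ x. g x \<partial>IT.eP n \<omega> \<partial>IT.C 0 n (\<lambda>_. undefined))"
    using IT.measurable_eP[of n] IT.sets_C[of "\<lambda>_. undefined" 0 n]
    by (simp add: nn_integral_bind[OF g] cong: measurable_cong_sets)
  also have "\<dots> = (\<integral>\<^sup>+ \<omega>. G \<omega> \<partial>IT.C 0 n (\<lambda>_. undefined))"
    by (intro nn_integral_cong) (simp add: sp G_eq)
  finally show "(\<integral>\<^sup>+ \<omega>. g (restrict \<omega> {0..<Suc n}) \<partial>traj_law F \<theta> \<pi>) =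
      (\<integral>\<^sup>+ \<omega>. G (restrict \<omega> {0..<n}) \<partial>traj_law F \<theta> \<pi>)"
    by (simp only: C[OF g] C[OF G])
qed

text \<open>The dynamics are exchanged one step at a time, starting from the last. Integrating out
  the last step under \<open>\<theta>'\<close> instead of \<open>\<theta>\<close> costs a fixed
  amount and leaves a function of \<open>n\<close> steps with the same bound \<open>B\<close>, to
  which the induction hypothesis applies. The integrand changes on the way, hence the induction over
  all \<open>g\<close>.\<close>

lemma nn_integral_traj_law_le:
  assumes \<theta>: "\<theta> \<in> space (params F)" "\<theta>' \<in> space (params F)" and \<pi>: "policy F \<pi>"
    and \<eta>: "\<And>x s. x \<in> space (step_ref F) \<Longrightarrow> s \<in> space (state_ref F) \<Longrightarrow>
      ennreal (trans_density F \<theta> x s) \<le> ennreal (trans_density F \<theta>' x s) + \<eta>"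
    and g: "g \<in> borel_measurable (\<Pi>\<^sub>M i\<in>{0..<n}. step_ref F)"
    and B: "\<And>\<omega>. \<omega> \<in> space (\<Pi>\<^sub>M i\<in>{0..<n}. step_ref F) \<Longrightarrow> g \<omega> \<le> B"
  shows "(\<integral>\<^sup>+ \<omega>. g (restrict \<omega> {0..<n}) \<partial>traj_law F \<theta> \<pi>) \<le>
    (\<integral>\<^sup>+ \<omega>. g (restrict \<omega> {0..<n}) \<partial>traj_law F \<theta>' \<pi>) +
      of_nat n * (\<eta> * B * emeasure (state_ref F) (space (state_ref F)))"
  using g B
proof (induction n arbitrary: g)
  case 0
  then show ?case
    by (simp add: prob_space.emeasure_space_1[OF prob_space_traj_law] \<theta> \<pi>)
next
  case (Suc n)
  define c where "c = \<eta> * B * emeasure (state_ref F) (space (state_ref F))"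
  define G where "G \<theta> \<omega> = (\<integral>\<^sup>+ x. g (fun_upd \<omega> n x) \<partial>step_kernel F \<theta> \<pi> n \<omega>)" for \<theta> \<omega>
  note G = nn_integral_traj_law_Suc[OF _ \<pi> Suc.prems(1), folded G_def]
  interpret T: prob_space "traj_law F \<theta> \<pi>"
    by (rule prob_space_traj_law[OF \<theta>(1) \<pi>])
  have r: "(\<lambda>\<omega>. restrict \<omega> {0..<n}) \<in> traj_law F \<theta> \<pi> \<rightarrow>\<^sub>M (\<Pi>\<^sub>M i\<in>{0..<n}. step_ref F)"
    using measurable_restrict_traj by (simp add: measurable_cong_sets[OF sets_traj_law[OF \<theta>(1) \<pi>] refl])
  have upd: "fun_upd \<omega> n x \<in> space (\<Pi>\<^sub>M i\<in>{0..<Suc n}. step_ref F)"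
    if "\<omega> \<in> space (\<Pi>\<^sub>M i\<in>{0..<n}. step_ref F)" "x \<in> space (step_ref F)" for \<omega> x
    using measurable_space[OF measurable_fun_upd_step[OF that(1)] that(2)] .
  have le: "G \<theta> \<omega> \<le> G \<theta>' \<omega> + c" if \<omega>: "\<omega> \<in> space (\<Pi>\<^sub>M i\<in>{0..<n}. step_ref F)" for \<omega>
    unfolding G_def c_def
    by (rule nn_integral_step_kernel_le[OF \<theta> \<pi> \<omega> \<eta>])
      (auto intro: measurable_compose[OF measurable_fun_upd_step[OF \<omega>] Suc.prems(1)]
        Suc.prems(2) upd \<omega>)
  \<comment> \<open>The step kernel is a probability measure, so the bound does not grow. Every
    exchange therefore costs the same \<open>c\<close>, and the total error is linear in the
    horizon.\<close>
  have bound: "G \<theta>' \<omega> \<le> B" if \<omega>: "\<omega> \<in> space (\<Pi>\<^sub>M i\<in>{0..<n}. step_ref F)" for \<omega>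
  proof -
    have "G \<theta>' \<omega> \<le> (\<integral>\<^sup>+ x. B \<partial>step_kernel F \<theta>' \<pi> n \<omega>)"
      unfolding G_def using sets_eq_imp_space_eq[OF sets_step_kernel]
      by (intro nn_integral_mono Suc.prems(2) upd \<omega>) auto
    also have "\<dots> = B"
      by (simp add: prob_space.emeasure_space_1[OF prob_space_step_kernel[OF \<theta>(2) \<pi> \<omega>]])
    finally show ?thesis .
  qed
  have "(\<integral>\<^sup>+ \<omega>. g (restrict \<omega> {0..<Suc n}) \<partial>traj_law F \<theta> \<pi>) =
      (\<integral>\<^sup>+ \<omega>. G \<theta> (restrict \<omega> {0..<n}) \<partial>traj_law F \<theta> \<pi>)"
    by (rule G(2)[OF \<theta>(1)])
  \<comment> \<open>At this point the last step follows \<open>\<theta>'\<close> while the first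
    \<open>n\<close> steps still follow \<open>\<theta>\<close>; the induction hypothesis for
    \<open>G \<theta>'\<close> then exchanges those.\<close>
  also have "\<dots> \<le> (\<integral>\<^sup>+ \<omega>. G \<theta>' (restrict \<omega> {0..<n}) + c \<partial>traj_law F \<theta> \<pi>)"
    by (intro nn_integral_mono le measurable_space[OF r])
  also have "\<dots> = (\<integral>\<^sup>+ \<omega>. G \<theta>' (restrict \<omega> {0..<n}) \<partial>traj_law F \<theta> \<pi>) + c"
    using measurable_compose[OF r G(1)[OF \<theta>(2)]]
    by (subst nn_integral_add) (auto simp: T.emeasure_space_1)
  also have "\<dots> \<le> (\<integral>\<^sup>+ \<omega>. G \<theta>' (restrict \<omega> {0..<n}) \<partial>traj_law F \<theta>' \<pi>) + of_nat n * c + c"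
    unfolding c_def by (intro add_right_mono Suc.IH G(1) \<theta> bound)
  also have "\<dots> = (\<integral>\<^sup>+ \<omega>. g (restrict \<omega> {0..<Suc n}) \<partial>traj_law F \<theta>' \<pi>) + of_nat (Suc n) * c"
    by (simp add: G(2)[OF \<theta>(2)] distrib_right add_ac)
  finally show ?case
    unfolding c_def .
qed


section \<open>Lipschitz dependence of the value on the transition density\<close>

text \<open>The reward at time \<open>t\<close> depends on the coordinates 0 to \<open>t\<close>, so
  the horizon is \<open>Suc t\<close>; shifted by \<open>R\<close>, it takes values between 0 and
  \<open>2 * R\<close>, which serves as the bound in the finite-horizon comparison.\<close>

lemma integral_reward_diff_le:
  assumes \<theta>: "\<theta> \<in> space (params F)" "\<theta>' \<in> space (params F)" and \<pi>: "policy F \<pi>"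
    and fin: "finite_measure (state_ref F)"
    and \<eta>: "\<And>x s. x \<in> space (step_ref F) \<Longrightarrow> s \<in> space (state_ref F) \<Longrightarrow>
      \<bar>trans_density F \<theta> x s - trans_density F \<theta>' x s\<bar> \<le> \<eta>" "0 \<le> \<eta>"
    and R: "\<And>x. x \<in> space (step_ref F) \<Longrightarrow> \<bar>reward F x\<bar> \<le> R" "0 \<le> R"
  shows "(\<integral>\<omega>. reward F (\<omega> t) \<partial>traj_law F \<theta> \<pi>) \<le> (\<integral>\<omega>. reward F (\<omega> t) \<partial>traj_law F \<theta>' \<pi>) +
    real (Suc t) * (\<eta> * (2 * R) * measure (state_ref F) (space (state_ref F)))"
proof -
  interpret S: finite_measure "state_ref F"
    by (rule fin)
  \<comment> \<open>The shift by \<open>R\<close> makes the reward non-negative, so that Lebesgue integrals in \<open>[0, \<infinity>]\<close> apply.\<close>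
  define g where "g \<omega> = ennreal (reward F (\<omega> t) + R)" for \<omega> :: "nat \<Rightarrow> 's \<times> 'a"
  define c where "c = \<eta> * (2 * R) * measure (state_ref F) (space (state_ref F))"
  have c: "0 \<le> c"
    using \<eta>(2) R(2) by (simp add: c_def)
  have g: "g \<in> borel_measurable (\<Pi>\<^sub>M i\<in>{0..<Suc t}. step_ref F)"
    unfolding g_def
    by (intro measurable_compose[OF _ measurable_ennreal] borel_measurable_add borel_measurable_const
      measurable_reward_component) simp
  have g_le: "g \<omega> \<le> ennreal (2 * R)" if "\<omega> \<in> space (\<Pi>\<^sub>M i\<in>{0..<Suc t}. step_ref F)" for \<omega>
  proof -
    have "\<omega> t \<in> space (step_ref F)"
      using that by (auto simp: space_PiM)
    from R(1)[OF this] show ?thesis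
      unfolding g_def by (intro ennreal_leI) simp
  qed
  \<comment> \<open>Since \<open>ennreal\<close> sends negative reals to 0, the sign of the shifted
    mean is recorded as well; it permits the return to an inequality of reals at the end.\<close>
  have E: "(\<integral>\<^sup>+ \<omega>. g (restrict \<omega> {0..<Suc t}) \<partial>traj_law F \<theta> \<pi>) =
      ennreal ((\<integral>\<omega>. reward F (\<omega> t) \<partial>traj_law F \<theta> \<pi>) + R)"
      "0 \<le> (\<integral>\<omega>. reward F (\<omega> t) \<partial>traj_law F \<theta> \<pi>) + R"
    if \<theta>: "\<theta> \<in> space (params F)" for \<theta>
  proof -
    interpret T: prob_space "traj_law F \<theta> \<pi>"
      by (rule prob_space_traj_law[OF \<theta> \<pi>])
    have sp: "\<omega> t \<in> space (step_ref F)" if "\<omega> \<in> space (traj_law F \<theta> \<pi>)" for \<omega>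
      using that sets_eq_imp_space_eq[OF sets_traj_law[OF \<theta> \<pi>]] by (auto simp: traj_space_def space_PiM)
    have "(\<lambda>\<omega>. reward F (\<omega> t)) \<in> borel_measurable (traj_law F \<theta> \<pi>)"
      unfolding measurable_cong_sets[OF sets_traj_law[OF \<theta> \<pi>] refl] traj_space_def
      by (rule measurable_reward_component) simp
    then have int: "integrable (traj_law F \<theta> \<pi>) (\<lambda>\<omega>. reward F (\<omega> t))"
      using R(1)[OF sp] by (intro T.integrable_const_bound[where B=R]) auto
    have nonneg: "0 \<le> reward F (\<omega> t) + R" if "\<omega> \<in> space (traj_law F \<theta> \<pi>)" for \<omega>
      using R(1)[OF sp[OF that]] by simp
    have eq: "(\<integral>\<omega>. reward F (\<omega> t) \<partial>traj_law F \<theta> \<pi>) + R = (\<integral>\<omega>. reward F (\<omega> t) + R \<partial>traj_law F \<theta> \<pi>)"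
      using int by (simp add: T.prob_space)
    show "0 \<le> (\<integral>\<omega>. reward F (\<omega> t) \<partial>traj_law F \<theta> \<pi>) + R"
      unfolding eq by (intro integral_nonneg_AE AE_I2 nonneg)
    show "(\<integral>\<^sup>+ \<omega>. g (restrict \<omega> {0..<Suc t}) \<partial>traj_law F \<theta> \<pi>) =
        ennreal ((\<integral>\<omega>. reward F (\<omega> t) \<partial>traj_law F \<theta> \<pi>) + R)"
      unfolding eq using int nonneg by (subst nn_integral_eq_integral[symmetric]) (auto simp: g_def)
  qed
  have "(\<integral>\<^sup>+ \<omega>. g (restrict \<omega> {0..<Suc t}) \<partial>traj_law F \<theta> \<pi>) \<le>
      (\<integral>\<^sup>+ \<omega>. g (restrict \<omega> {0..<Suc t}) \<partial>traj_law F \<theta>' \<pi>) +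
      of_nat (Suc t) * (ennreal \<eta> * ennreal (2 * R) * emeasure (state_ref F) (space (state_ref F)))"
  proof (rule nn_integral_traj_law_le[OF \<theta> \<pi> _ g g_le])
    fix x s assume xs: "x \<in> space (step_ref F)" "s \<in> space (state_ref F)"
    have "ennreal (trans_density F \<theta> x s) \<le> ennreal (trans_density F \<theta>' x s + \<eta>)"
      using \<eta>(1)[OF xs] by (intro ennreal_leI) simp
    then show "ennreal (trans_density F \<theta> x s) \<le> ennreal (trans_density F \<theta>' x s) + ennreal \<eta>"
      using trans_nonneg[OF \<theta>(2) xs] \<eta>(2) by simp
  qed
  also have "ennreal \<eta> * ennreal (2 * R) * emeasure (state_ref F) (space (state_ref F)) = ennreal c"
    unfolding c_def S.emeasure_eq_measure
    using \<eta>(2) R(2)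
    by (simp only: ennreal_mult[symmetric] mult_nonneg_nonneg measure_nonneg)
  also have "of_nat (Suc t) * ennreal c = ennreal (real (Suc t) * c)"
    using c by (subst ennreal_mult) (auto simp: ennreal_of_nat_eq_real_of_nat)
  finally have "ennreal ((\<integral>\<omega>. reward F (\<omega> t) \<partial>traj_law F \<theta> \<pi>) + R) \<le>
      ennreal ((\<integral>\<omega>. reward F (\<omega> t) \<partial>traj_law F \<theta>' \<pi>) + R + real (Suc t) * c)"
    using c E(2)[OF \<theta>(2)] by (simp only: E(1)[OF \<theta>(1)] E(1)[OF \<theta>(2)]) (simp add: ennreal_plus)
  then show ?thesis
    using c E(2)[OF \<theta>(2)] unfolding c_def[symmetric] by (subst (asm) ennreal_le_iff) auto
qed

text \<open>The geometric majorant \<open>\<gamma> ^ t * R\<close> dominates the discounted rewards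
  both pointwise and in mean, so the sum and the expectation may be interchanged.\<close>

lemma policy_value_sums:
  assumes \<theta>: "\<theta> \<in> space (params F)" and \<pi>: "policy F \<pi>" and \<gamma>: "0 \<le> \<gamma>" "\<gamma> < 1"
    and R: "\<And>x. x \<in> space (step_ref F) \<Longrightarrow> \<bar>reward F x\<bar> \<le> R"
  shows "(\<lambda>t. \<gamma> ^ t * (\<integral>\<omega>. reward F (\<omega> t) \<partial>traj_law F \<theta> \<pi>)) sums policy_value F \<gamma> \<theta> \<pi>"
proof -
  interpret T: prob_space "traj_law F \<theta> \<pi>"
    by (rule prob_space_traj_law[OF \<theta> \<pi>])
  have R_sp: "\<bar>reward F (\<omega> t)\<bar> \<le> R" if "\<omega> \<in> space (traj_law F \<theta> \<pi>)" for \<omega> t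
    using that sets_eq_imp_space_eq[OF sets_traj_law[OF \<theta> \<pi>]]
    by (intro R) (auto simp: traj_space_def space_PiM)
  have "(\<lambda>\<omega>. reward F (\<omega> t)) \<in> borel_measurable (traj_law F \<theta> \<pi>)" for t
    unfolding measurable_cong_sets[OF sets_traj_law[OF \<theta> \<pi>] refl] traj_space_def
    by (rule measurable_reward_component) simp
  then have int: "integrable (traj_law F \<theta> \<pi>) (\<lambda>\<omega>. reward F (\<omega> t))" for t
    using R_sp by (intro T.integrable_const_bound[where B=R]) auto
  have sm: "summable (\<lambda>t. \<gamma> ^ t * R)"
    using \<gamma> by (intro summable_mult2 summable_geometric) simp
  have "(\<lambda>t. \<integral>\<omega>. \<gamma> ^ t * reward F (\<omega> t) \<partial>traj_law F \<theta> \<pi>) sums policy_value F \<gamma> \<theta> \<pi>"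
    unfolding policy_value_def
  proof (rule sums_integral)
    show "integrable (traj_law F \<theta> \<pi>) (\<lambda>\<omega>. \<gamma> ^ t * reward F (\<omega> t))" for t
      using int by simp
    show "AE \<omega> in traj_law F \<theta> \<pi>. summable (\<lambda>t. norm (\<gamma> ^ t * reward F (\<omega> t)))"
      using \<gamma> R_sp
      by (intro AE_I2 summable_comparison_test'[OF sm, of 0]) (auto simp: abs_mult intro!: mult_left_mono)
    have "(\<integral>\<omega>. norm (\<gamma> ^ t * reward F (\<omega> t)) \<partial>traj_law F \<theta> \<pi>) \<le> \<gamma> ^ t * R" for t
      using int R_sp \<gamma>
      by (intro T.integral_le_const) (auto simp: abs_mult intro!: mult_left_mono)
    then show "summable (\<lambda>t. \<integral>\<omega>. norm (\<gamma> ^ t * reward F (\<omega> t)) \<partial>traj_law F \<theta> \<pi>)"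
      by (intro summable_comparison_test'[OF sm, of 0]) auto
  qed
  then show ?thesis
    by simp
qed

text \<open>The mean rewards at time \<open>t\<close> differ by at most \<open>t + 1\<close> times a
  constant, and the sum of \<open>(t + 1) * \<gamma> ^ t\<close> is
  \<open>1 / (1 - \<gamma>)\<^sup>2\<close>, the derivative of the geometric series.\<close>

lemma policy_value_diff_le:
  assumes \<theta>: "\<theta> \<in> space (params F)" "\<theta>' \<in> space (params F)" and \<pi>: "policy F \<pi>"
    and \<gamma>: "0 \<le> \<gamma>" "\<gamma> < 1"
    and fin: "finite_measure (state_ref F)"
    and \<eta>: "\<And>x s. x \<in> space (step_ref F) \<Longrightarrow> s \<in> space (state_ref F) \<Longrightarrow>
      \<bar>trans_density F \<theta> x s - trans_density F \<theta>' x s\<bar> \<le> \<eta>" "0 \<le> \<eta>"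
    and R: "\<And>x. x \<in> space (step_ref F) \<Longrightarrow> \<bar>reward F x\<bar> \<le> R" "0 \<le> R"
  shows "\<bar>policy_value F \<gamma> \<theta> \<pi> - policy_value F \<gamma> \<theta>' \<pi>\<bar> \<le>
    2 * R * measure (state_ref F) (space (state_ref F)) / (1 - \<gamma>)\<^sup>2 * \<eta>"
proof -
  define c where "c = \<eta> * (2 * R) * measure (state_ref F) (space (state_ref F))"
  \<comment> \<open>The one-sided estimate is proved for an arbitrary pair of parameters so that it
    can be applied again with the two interchanged.\<close>
  have le: "policy_value F \<gamma> \<theta> \<pi> \<le> policy_value F \<gamma> \<theta>' \<pi> + 1 / (1 - \<gamma>)\<^sup>2 * c"
    if \<theta>: "\<theta> \<in> space (params F)" "\<theta>' \<in> space (params F)"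
      and \<eta>': "\<And>x s. x \<in> space (step_ref F) \<Longrightarrow> s \<in> space (state_ref F) \<Longrightarrow>
        \<bar>trans_density F \<theta> x s - trans_density F \<theta>' x s\<bar> \<le> \<eta>" for \<theta> \<theta>'
  proof (rule sums_le)
    show "(\<lambda>t. \<gamma> ^ t * (\<integral>\<omega>. reward F (\<omega> t) \<partial>traj_law F \<theta> \<pi>)) sums policy_value F \<gamma> \<theta> \<pi>"
      by (rule policy_value_sums[OF \<theta>(1) \<pi> \<gamma> R(1)])
    show "(\<lambda>t. \<gamma> ^ t * (\<integral>\<omega>. reward F (\<omega> t) \<partial>traj_law F \<theta>' \<pi>) + real (Suc t) * \<gamma> ^ t * c) sums
        (policy_value F \<gamma> \<theta>' \<pi> + 1 / (1 - \<gamma>)\<^sup>2 * c)"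
      using \<gamma> geometric_deriv_sums[of \<gamma>]
      by (intro sums_add sums_mult2 policy_value_sums[OF \<theta>(2) \<pi> \<gamma> R(1)]) auto
    fix t
    have "\<gamma> ^ t * (\<integral>\<omega>. reward F (\<omega> t) \<partial>traj_law F \<theta> \<pi>) \<le>
        \<gamma> ^ t * ((\<integral>\<omega>. reward F (\<omega> t) \<partial>traj_law F \<theta>' \<pi>) + real (Suc t) * c)"
      unfolding c_def using \<gamma>
      by (intro mult_left_mono integral_reward_diff_le \<theta> \<pi> fin \<eta>' \<eta>(2) R) auto
    then show "\<gamma> ^ t * (\<integral>\<omega>. reward F (\<omega> t) \<partial>traj_law F \<theta> \<pi>) \<le>
        \<gamma> ^ t * (\<integral>\<omega>. reward F (\<omega> t) \<partial>traj_law F \<theta>' \<pi>) + real (Suc t) * \<gamma> ^ t * c"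
      by (simp add: algebra_simps)
  qed
  have "policy_value F \<gamma> \<theta> \<pi> \<le> policy_value F \<gamma> \<theta>' \<pi> + 1 / (1 - \<gamma>)\<^sup>2 * c"
    by (rule le[OF \<theta> \<eta>(1)])
  moreover have "policy_value F \<gamma> \<theta>' \<pi> \<le> policy_value F \<gamma> \<theta> \<pi> + 1 / (1 - \<gamma>)\<^sup>2 * c"
    by (rule le[OF \<theta>(2,1)]) (simp add: \<eta>(1) abs_minus_commute)
  ultimately show ?thesis
    by (simp add: c_def mult_ac)
qed

section \<open>Total mass of the reference measures\<close>

text \<open>A density bounded by a constant can integrate to one only if the constant times the
  total mass is at least one. This applies to the policy density on the actions and to the
  transition density on the states, and the two inequalities are multiplied.\<close>

lemma
  assumes fin: "emeasure (step_ref F) (space (step_ref F)) < \<infinity>"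
    and \<theta>: "\<theta> \<in> space (params F)" and \<pi>: "policy F \<pi>"
    and C1: "\<And>\<omega> a. \<omega> \<in> space (traj_space F) \<Longrightarrow> a \<in> space (action_ref F) \<Longrightarrow>
      \<pi> t (history F t \<omega>) a \<le> C\<^sub>1" "0 \<le> C\<^sub>1"
    and C2: "\<And>x s. x \<in> space (step_ref F) \<Longrightarrow> s \<in> space (state_ref F) \<Longrightarrow>
      trans_density F \<theta> x s \<le> C\<^sub>2" "0 \<le> C\<^sub>2"
  shows finite_measure_state_ref: "finite_measure (state_ref F)"
    and one_le_density_bounds: "1 \<le> C\<^sub>1 * C\<^sub>2 * measure (step_ref F) (space (step_ref F))"
proof -
  interpret A: sigma_finite_measure "action_ref F"
    by (rule sigma_finite_action_ref)
  interpret T: prob_space "traj_law F \<theta> \<pi>"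
    by (rule prob_space_traj_law[OF \<theta> \<pi>])
  \<comment> \<open>A probability space is non-empty; one trajectory supplies the history and the
    state-action pair at which the two densities are evaluated.\<close>
  obtain \<omega> where \<omega>: "\<omega> \<in> space (traj_space F)"
    using T.not_empty sets_eq_imp_space_eq[OF sets_traj_law[OF \<theta> \<pi>]] by auto
  then have x: "\<omega> 0 \<in> space (step_ref F)"
    by (auto simp: traj_space_def space_PiM)
  have "1 = (\<integral>\<^sup>+ a. ennreal (\<pi> t (history F t \<omega>) a) \<partial>action_ref F)"
    using \<pi> measurable_space[OF measurable_history \<omega>] by (simp add: policy_def)
  also have "\<dots> \<le> (\<integral>\<^sup>+ a. ennreal C\<^sub>1 \<partial>action_ref F)"
    by (intro nn_integral_mono ennreal_leI C1 \<omega>)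
  finally have A: "1 \<le> ennreal C\<^sub>1 * emeasure (action_ref F) (space (action_ref F))"
    by simp
  have "1 = (\<integral>\<^sup>+ s. ennreal (trans_density F \<theta> (\<omega> 0) s) \<partial>state_ref F)"
    using trans_integral[OF \<theta> x] by simp
  also have "\<dots> \<le> (\<integral>\<^sup>+ s. ennreal C\<^sub>2 \<partial>state_ref F)"
    by (intro nn_integral_mono ennreal_leI C2 x)
  finally have S: "1 \<le> ennreal C\<^sub>2 * emeasure (state_ref F) (space (state_ref F))"
    by simp
  have eq: "emeasure (step_ref F) (space (step_ref F)) =
      emeasure (state_ref F) (space (state_ref F)) * emeasure (action_ref F) (space (action_ref F))"
    unfolding step_ref_def space_pair_measure by (rule A.emeasure_pair_measure_Times) auto
  \<comment> \<open>Because \<open>\<infinity> * 0 = 0\<close> in \<open>ennreal\<close>, finiteness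
    of the product measure gives finiteness of the state factor only once the action factor is known
    to be non-zero.\<close>
  have "emeasure (action_ref F) (space (action_ref F)) \<noteq> 0"
    using A by auto
  with fin eq show "finite_measure (state_ref F)"
    by (intro finite_measureI) (auto simp: ennreal_top_mult)
  have "1 * 1 \<le> (ennreal C\<^sub>1 * emeasure (action_ref F) (space (action_ref F))) *
      (ennreal C\<^sub>2 * emeasure (state_ref F) (space (state_ref F)))"
    by (intro mult_mono A S) auto
  also have "\<dots> = ennreal C\<^sub>1 * ennreal C\<^sub>2 * emeasure (step_ref F) (space (step_ref F))"
    by (simp add: eq mult_ac)
  also have "\<dots> = ennreal (C\<^sub>1 * C\<^sub>2 * measure (step_ref F) (space (step_ref F)))"
    using fin C1(2) C2(2) by (simp add: emeasure_eq_ennreal_measure ennreal_mult)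
  finally show "1 \<le> C\<^sub>1 * C\<^sub>2 * measure (step_ref F) (space (step_ref F))"
    by simp
qed

end

section \<open>Transfer of posterior contraction rates\<close>

text \<open>Outer measure is monotone on arbitrary sets; this is used once for the posterior and
  once for the law of the data. Inclusion for large \<open>t\<close> is enough, since only a limit
  is claimed.\<close>

lemma posterior_vanishes_subset:
  assumes "posterior_vanishes F \<theta> \<pi> K B" and "\<forall>\<^sub>F t in sequentially. A t \<subseteq> B t"
  shows "posterior_vanishes F \<theta> \<pi> K A"
  unfolding posterior_vanishes_def tendsto_zero_in_prob_def
proof (intro allI impI)
  fix \<delta> :: real assume "0 < \<delta>"
  let ?X = "\<lambda>A t. outer_measure_of (traj_law F \<theta> \<pi>)
    {\<omega>\<in>space (traj_law F \<theta> \<pi>). ennreal \<delta> < outer_measure_of (K t (history F t \<omega>)) (A t)}"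
  from \<open>0 < \<delta>\<close> assms(1) have "?X B \<longlonglongrightarrow> 0"
    by (simp add: posterior_vanishes_def tendsto_zero_in_prob_def)
  moreover have "\<forall>\<^sub>F t in sequentially. ?X A t \<le> ?X B t"
    using assms(2)
  proof eventually_elim
    case (elim t)
    then show ?case
      by (intro outer_measure_of_mono) (auto intro: less_le_trans outer_measure_of_mono)
  qed
  ultimately show "?X A \<longlonglongrightarrow> 0"
    by (intro tendsto_sandwich[of "\<lambda>_. 0" "?X A" sequentially "?X B"]) auto
qed

text \<open>If \<open>f \<theta>\<close> exceeds \<open>M t * \<epsilon> t powr \<rho>\<close> and
  is at most \<open>L\<close> times the power \<open>\<rho>\<close> of the distance, then taking
  roots shows that the distance exceeds \<open>(M t / L) powr (1 / \<rho>) * \<epsilon> t\<close>.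
  The new factor again tends to infinity, so the contraction assumption covers it.\<close>

lemma posterior_vanishes_powr_rate:
  assumes contraction: "\<And>M. filterlim M at_top sequentially \<Longrightarrow>
      posterior_vanishes F \<theta>\<^sub>0 \<pi> K (\<lambda>t. {\<theta>\<in>\<Theta>. d \<theta> > ennreal (M t * \<epsilon> t)})"
    and \<rho>: "0 < \<rho>" and \<epsilon>: "\<And>t. 0 < \<epsilon> t" and L: "0 < L"
    and f: "\<And>\<theta>. \<theta> \<in> \<Theta> \<Longrightarrow> d \<theta> \<noteq> \<infinity> \<Longrightarrow> f \<theta> \<le> L * enn2real (d \<theta>) powr \<rho>"
    and M: "filterlim M at_top sequentially"
  shows "posterior_vanishes F \<theta>\<^sub>0 \<pi> K (\<lambda>t. {\<theta>\<in>\<Theta>. f \<theta> > M t * \<epsilon> t powr \<rho>})"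
proof (rule posterior_vanishes_subset)
  define N where "N t = (M t / L) powr (1 / \<rho>)" for t
  have "filterlim N at_top sequentially"
    unfolding filterlim_at_top
  proof
    fix Z
    \<comment> \<open>Truncating \<open>Z\<close> at 0 puts it in the range where taking the power
      \<open>\<rho>\<close> and then the power \<open>1 / \<rho>\<close> gives back the same
      number.\<close>
    have "\<forall>\<^sub>F t in sequentially. L * (max Z 0) powr \<rho> \<le> M t"
      using M by (simp add: filterlim_at_top)
    then show "\<forall>\<^sub>F t in sequentially. Z \<le> N t"
    proof eventually_elim
      case (elim t)
      have "Z \<le> (max Z 0 powr \<rho>) powr (1 / \<rho>)"
        using \<rho> by (simp add: powr_powr)
      also have "\<dots> \<le> N t"
        unfolding N_def using elim L \<rho> by (intro powr_mono2) (auto simp: field_simps)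
      finally show ?case .
    qed
  qed
  then show "posterior_vanishes F \<theta>\<^sub>0 \<pi> K (\<lambda>t. {\<theta>\<in>\<Theta>. d \<theta> > ennreal (N t * \<epsilon> t)})"
    by (rule contraction)
  \<comment> \<open>The roots are meaningful only for positive \<open>M t\<close>, which holds from
    some time on; hence an eventual inclusion.\<close>
  have "\<forall>\<^sub>F t in sequentially. 0 < M t"
    using M by (simp add: filterlim_at_top_dense)
  then show "\<forall>\<^sub>F t in sequentially. {\<theta>\<in>\<Theta>. f \<theta> > M t * \<epsilon> t powr \<rho>} \<subseteq>
      {\<theta>\<in>\<Theta>. d \<theta> > ennreal (N t * \<epsilon> t)}"
  proof eventually_elim
    case (elim t)
    have "ennreal (N t * \<epsilon> t) < d \<theta>" if \<theta>: "\<theta> \<in> \<Theta>" and gap: "M t * \<epsilon> t powr \<rho> < f \<theta>" for \<theta>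
    \<comment> \<open>At infinite distance nothing is known about \<open>f \<theta>\<close>, but
      such a parameter lies in the larger set anyway.\<close>
    proof (cases "d \<theta>")
      case (real r)
      have "M t / L * \<epsilon> t powr \<rho> < r powr \<rho>"
        using f[OF \<theta>] gap real L by (simp add: field_simps)
      then have "(M t / L * \<epsilon> t powr \<rho>) powr (1 / \<rho>) < (r powr \<rho>) powr (1 / \<rho>)"
        using elim L \<rho> by (intro powr_less_mono2) auto
      moreover have "(M t / L * \<epsilon> t powr \<rho>) powr (1 / \<rho>) = N t * \<epsilon> t"
        unfolding N_def using elim L \<rho> \<epsilon>[of t] by (subst powr_mult) (auto simp: powr_powr)
      ultimately have "N t * \<epsilon> t < r"
        using \<rho> real by (simp add: powr_powr)
      then show ?thesis
        using real \<epsilon>[of t] by (simp add: N_def ennreal_lessI less_le_trans ennreal_less_iff)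
    qed simp
    then show ?case
      by auto
  qed
qed

section \<open>Posterior contraction of the three value gaps\<close>

theorem corollary2p1:
  fixes F :: "('s, 'a, 'p) mdp_family"
    and \<theta>\<^sub>0 :: 'p
    and Pol :: "('s, 'a) policy set"
    and opt :: "'p \<Rightarrow> ('s, 'a) policy"
    and \<gamma> C\<^sub>1 C\<^sub>2 C\<^sub>3 C\<^sub>4 \<rho> :: real
    and \<mu> :: "'s \<times> 'a \<Rightarrow> real"
    and \<pi> :: "('s, 'a) policy"
    and prior :: "nat \<Rightarrow> 'p measure"
    and post :: "nat \<Rightarrow> ('s, 'a) history \<Rightarrow> 'p measure"
    and \<epsilon> :: "nat \<Rightarrow> real"
  assumes "mdp_family F"
    and "\<theta>\<^sub>0 \<in> space (params F)"
    and "\<And>\<pi>'. \<pi>' \<in> Pol \<Longrightarrow> policy F \<pi>'"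
    and "\<And>\<theta>. \<theta> \<in> space (params F) \<Longrightarrow> optimal_policy F \<gamma> Pol \<theta> (opt \<theta>)"
    and "0 < \<gamma>" "\<gamma> \<le> 1"
    and "\<mu> \<in> borel_measurable (step_ref F)"
    and "\<And>x. x \<in> space (step_ref F) \<Longrightarrow> 0 \<le> \<mu> x"
    and "policy F \<pi>"
    and "\<And>t. prob_space (prior t)" "\<And>t. sets (prior t) = sets (params F)"
    and "\<And>t. posterior F \<pi> (prior t) t (post t)"
    and "\<And>t. 0 < \<epsilon> t" "\<epsilon> \<longlonglongrightarrow> 0"
    and "emeasure (step_ref F) (space (step_ref F)) < \<infinity>"
    and "0 < C\<^sub>1" "0 < C\<^sub>2" "0 < C\<^sub>3" "0 < C\<^sub>4"
    and "\<gamma> * C\<^sub>1 * C\<^sub>2 * measure (step_ref F) (space (step_ref F)) < 1"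
    and cond_i: "\<And>\<pi>' t \<omega> a. \<pi>' \<in> Pol \<Longrightarrow> \<omega> \<in> space (traj_space F) \<Longrightarrow>
      a \<in> space (action_ref F) \<Longrightarrow> \<pi>' t (history F t \<omega>) a \<le> C\<^sub>1"
    and cond_ii: "\<And>\<theta> s a s'. \<theta> \<in> space (params F) \<Longrightarrow> s \<in> space (state_ref F) \<Longrightarrow>
      a \<in> space (action_ref F) \<Longrightarrow> s' \<in> space (state_ref F) \<Longrightarrow> trans_density F \<theta> (s, a) s' \<le> C\<^sub>2"
    and "0 < \<rho>" "\<rho> \<le> 1"
    and cond_iii: "\<And>\<theta> s a s'. \<theta> \<in> space (params F) \<Longrightarrow> s \<in> space (state_ref F) \<Longrightarrow>
      a \<in> space (action_ref F) \<Longrightarrow> s' \<in> space (state_ref F) \<Longrightarrow>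
      ennreal \<bar>trans_density F \<theta> (s, a) s' - trans_density F \<theta>\<^sub>0 (s, a) s'\<bar>
        \<le> ennreal C\<^sub>3 * epowr (d_mu F \<mu> \<theta> \<theta>\<^sub>0) \<rho>"
    and cond_iv: "\<And>s a. s \<in> space (state_ref F) \<Longrightarrow> a \<in> space (action_ref F) \<Longrightarrow>
      \<bar>reward F (s, a)\<bar> \<le> C\<^sub>4"
    and contraction: "\<And>M. filterlim M at_top sequentially \<Longrightarrow>
      posterior_vanishes F \<theta>\<^sub>0 \<pi> post
        (\<lambda>t. {\<theta>\<in>space (params F). d_mu F \<mu> \<theta> \<theta>\<^sub>0 > ennreal (M t * \<epsilon> t)})"
  shows "\<forall>\<pi>'\<in>Pol. \<forall>M. filterlim M at_top sequentially \<longrightarrow>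
      posterior_vanishes F \<theta>\<^sub>0 \<pi> post
        (\<lambda>t. {\<theta>\<in>space (params F).
          \<bar>policy_value F \<gamma> \<theta> \<pi>' - policy_value F \<gamma> \<theta>\<^sub>0 \<pi>'\<bar> > M t * \<epsilon> t powr \<rho>}) \<and>
      posterior_vanishes F \<theta>\<^sub>0 \<pi> post
        (\<lambda>t. {\<theta>\<in>space (params F).
          \<bar>policy_value F \<gamma> \<theta> (opt \<theta>) - policy_value F \<gamma> \<theta>\<^sub>0 (opt \<theta>\<^sub>0)\<bar> > M t * \<epsilon> t powr \<rho>}) \<and>
      posterior_vanishes F \<theta>\<^sub>0 \<pi> post
        (\<lambda>t. {\<theta>\<in>space (params F).
          \<bar>policy_value F \<gamma> \<theta>\<^sub>0 (opt \<theta>) - policy_value F \<gamma> \<theta>\<^sub>0 (opt \<theta>\<^sub>0)\<bar> > M t * \<epsilon> t powr \<rho>})"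
proof -
  interpret mdp_family F
    by fact
  have pair: "x \<in> space (step_ref F) \<longleftrightarrow> fst x \<in> space (state_ref F) \<and> snd x \<in> space (action_ref F)" for x
    by (auto simp: step_ref_def space_pair_measure mem_Times_iff)
  have R: "\<bar>reward F x\<bar> \<le> C\<^sub>4" if "x \<in> space (step_ref F)" for x
    using that cond_iv[of "fst x" "snd x"] by (simp add: pair)
  note opt = assms(4)
  \<comment> \<open>The mass bounds call for some member of \<open>Pol\<close>; the optimal policy
    at \<open>\<theta>\<^sub>0\<close> provides one.\<close>
  define \<pi>\<^sub>0 where "\<pi>\<^sub>0 = opt \<theta>\<^sub>0"
  have \<pi>\<^sub>0: "\<pi>\<^sub>0 \<in> Pol"
    using opt[OF assms(2)] by (simp add: optimal_policy_def \<pi>\<^sub>0_def)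
  have C1: "\<pi>\<^sub>0 0 (history F 0 \<omega>) a \<le> C\<^sub>1" if "\<omega> \<in> space (traj_space F)" "a \<in> space (action_ref F)" for \<omega> a
    using \<pi>\<^sub>0 that by (rule cond_i)
  have C2: "trans_density F \<theta>\<^sub>0 x s \<le> C\<^sub>2" if "x \<in> space (step_ref F)" "s \<in> space (state_ref F)" for x s
    using that cond_ii[OF assms(2), of "fst x" "snd x" s] by (simp add: pair)
  note mass = assms(15) assms(2) assms(3)[OF \<pi>\<^sub>0] C1 less_imp_le[OF \<open>0 < C\<^sub>1\<close>] C2 less_imp_le[OF \<open>0 < C\<^sub>2\<close>]
  have fin: "finite_measure (state_ref F)"
    by (rule finite_measure_state_ref[OF mass])
  have "\<gamma> * 1 \<le> \<gamma> * (C\<^sub>1 * C\<^sub>2 * measure (step_ref F) (space (step_ref F)))"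
    using \<open>0 < \<gamma>\<close> by (intro mult_left_mono one_le_density_bounds[OF mass]) auto
  then have \<gamma>: "\<gamma> < 1"
    using \<open>\<gamma> * C\<^sub>1 * C\<^sub>2 * measure (step_ref F) (space (step_ref F)) < 1\<close> by (simp add: mult.assoc)
  \<comment> \<open>The added 1 makes \<open>L\<close> positive at once, as the rate lemma divides
    by it.\<close>
  define L where "L = 2 * C\<^sub>4 * measure (state_ref F) (space (state_ref F)) / (1 - \<gamma>)\<^sup>2 * C\<^sub>3 + 1"
  have L: "0 < L"
    using \<open>0 < C\<^sub>3\<close> \<open>0 < C\<^sub>4\<close> unfolding L_def by (intro add_nonneg_pos) auto
  \<comment> \<open>\<open>enn2real\<close> sends \<open>\<infinity>\<close> to 0, so
    \<open>D \<theta>\<close> is a bound only at finite distance; the estimates below carry that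
    restriction.\<close>
  define D where "D \<theta> = enn2real (d_mu F \<mu> \<theta> \<theta>\<^sub>0) powr \<rho>" for \<theta>
  have D: "0 \<le> D \<theta>" for \<theta>
    by (simp add: D_def)
  have V: "\<bar>policy_value F \<gamma> \<theta> \<pi>' - policy_value F \<gamma> \<theta>\<^sub>0 \<pi>'\<bar> \<le> L * D \<theta>"
    if \<theta>: "\<theta> \<in> space (params F)" and d: "d_mu F \<mu> \<theta> \<theta>\<^sub>0 \<noteq> \<infinity>" and \<pi>': "\<pi>' \<in> Pol" for \<theta> \<pi>'
  proof -
    have "\<bar>trans_density F \<theta> x s - trans_density F \<theta>\<^sub>0 x s\<bar> \<le> C\<^sub>3 * D \<theta>"
      if "x \<in> space (step_ref F)" "s \<in> space (state_ref F)" for x s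
    proof -
      have "ennreal \<bar>trans_density F \<theta> x s - trans_density F \<theta>\<^sub>0 x s\<bar> \<le> ennreal (C\<^sub>3 * D \<theta>)"
        using that cond_iii[OF \<theta>, of "fst x" "snd x" s] d \<open>0 < C\<^sub>3\<close>
        by (simp add: pair epowr_def D_def ennreal_mult)
      then show ?thesis
        using D[of \<theta>] \<open>0 < C\<^sub>3\<close> by (simp add: ennreal_le_iff)
    qed
    then have "\<bar>policy_value F \<gamma> \<theta> \<pi>' - policy_value F \<gamma> \<theta>\<^sub>0 \<pi>'\<bar> \<le>
        2 * C\<^sub>4 * measure (state_ref F) (space (state_ref F)) / (1 - \<gamma>)\<^sup>2 * (C\<^sub>3 * D \<theta>)"
      using \<theta> assms(2) assms(3)[OF \<pi>'] \<open>0 < \<gamma>\<close> \<gamma> fin D[of \<theta>] \<open>0 < C\<^sub>3\<close> \<open>0 < C\<^sub>4\<close> R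
      by (intro policy_value_diff_le) auto
    also have "\<dots> \<le> L * D \<theta>"
      using D[of \<theta>] by (simp add: L_def algebra_simps)
    finally show ?thesis .
  qed
  have opt_Pol: "opt \<theta> \<in> Pol" if "\<theta> \<in> space (params F)" for \<theta>
    using opt[OF that] by (simp add: optimal_policy_def)
  have opt_le: "policy_value F \<gamma> \<theta> \<pi>' \<le> policy_value F \<gamma> \<theta> (opt \<theta>)"
    if "\<theta> \<in> space (params F)" "\<pi>' \<in> Pol" for \<theta> \<pi>'
    using opt[OF that(1)] that(2) by (simp add: optimal_policy_def)
  have rate: "posterior_vanishes F \<theta>\<^sub>0 \<pi> post (\<lambda>t. {\<theta>\<in>space (params F). f \<theta> > M t * \<epsilon> t powr \<rho>})"
    if "0 < L'" "filterlim M at_top sequentially"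
      "\<And>\<theta>. \<theta> \<in> space (params F) \<Longrightarrow> d_mu F \<mu> \<theta> \<theta>\<^sub>0 \<noteq> \<infinity> \<Longrightarrow> f \<theta> \<le> L' * D \<theta>" for f L' M
    by (rule posterior_vanishes_powr_rate[OF contraction \<open>0 < \<rho>\<close> assms(13) that(1) _ that(2)])
      (use that(3) in \<open>auto simp: D_def\<close>)
  \<comment> \<open>For the first gap, optimality at \<open>\<theta>\<^sub>0\<close> bounds it above
    by the value difference of \<open>opt \<theta>\<close>, and optimality at
    \<open>\<theta>\<close> bounds it below by that of \<open>opt \<theta>\<^sub>0\<close>. For the
    second, the upper bound 0 is optimality at \<open>\<theta>\<^sub>0\<close>; the lower bound
    passes from \<open>\<theta>\<^sub>0\<close> to \<open>\<theta>\<close> with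
    \<open>opt \<theta>\<close>, uses optimality there, and returns with
    \<open>opt \<theta>\<^sub>0\<close>, which costs \<open>L * D \<theta>\<close> twice.\<close>
  have gaps: "\<bar>policy_value F \<gamma> \<theta> (opt \<theta>) - policy_value F \<gamma> \<theta>\<^sub>0 (opt \<theta>\<^sub>0)\<bar> \<le> L * D \<theta>"
      "\<bar>policy_value F \<gamma> \<theta>\<^sub>0 (opt \<theta>) - policy_value F \<gamma> \<theta>\<^sub>0 (opt \<theta>\<^sub>0)\<bar> \<le> (2 * L) * D \<theta>"
    if \<theta>: "\<theta> \<in> space (params F)" and d: "d_mu F \<mu> \<theta> \<theta>\<^sub>0 \<noteq> \<infinity>" for \<theta>
  proof -
    note V[OF \<theta> d opt_Pol[OF \<theta>]] V[OF \<theta> d opt_Pol[OF assms(2)]]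
      opt_le[OF \<theta> opt_Pol[OF assms(2)]] opt_le[OF assms(2) opt_Pol[OF \<theta>]]
    then show "\<bar>policy_value F \<gamma> \<theta> (opt \<theta>) - policy_value F \<gamma> \<theta>\<^sub>0 (opt \<theta>\<^sub>0)\<bar> \<le> L * D \<theta>"
      "\<bar>policy_value F \<gamma> \<theta>\<^sub>0 (opt \<theta>) - policy_value F \<gamma> \<theta>\<^sub>0 (opt \<theta>\<^sub>0)\<bar> \<le> (2 * L) * D \<theta>"
      unfolding mult.assoc by linarith+
  qed
  show ?thesis
    using L by (intro ballI allI impI conjI rate[OF L _ V] rate[OF L _ gaps(1)] rate[OF _ _ gaps(2)]) auto
qed

end
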